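(* (i) $\bar{R}(3,3,3)=\bar{R}(4,3,3)=\bar{R}(5,3,3)=5$ and $\bar{R}(6,3,3)=6$. (ii) $\bar{R}(4,4,3)=7$, $\bar{R}(5,4,3)=\bar{R}(6,4,3)=8$, and $\bar{R}(7,4,3)=9$. (iii) $\bar{R}(4,4,4)=10$.
   Context: For a positive integer $n$, $[n]=\{1,\dots,n\}$. An edge-coloring of $K_n$ with $k$ colors is a map $f:\binom{[n]}{2}\to[k]$; for $i\in[k]$, $\alpha_i(f)$ is the independence number of the graph on $[n]$ whose edges are the pairs of color $i$. For positive integers $m_1,\dots,m_k$, the complementary Ramsey number $\bar{R}(m_1,\dots,m_k)$ is the least positive integer $n$ such that for every edge-coloring $f$ of $K_n$ with $k$ colors there exists $i\in[k]$ with $\alpha_i(f)\ge m_i$. *)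

theory Defs
  imports "HOL-Library.Ramsey"
begin

definition independence_number :: "'a set \<Rightarrow> 'a set set \<Rightarrow> nat" where
  "independence_number V E = Max {card S |S. S \<subseteq> V \<and> indep S E}"

definition edge_colorings :: "nat \<Rightarrow> nat \<Rightarrow> (nat set \<Rightarrow> nat) set" where
  "edge_colorings n k = [{1..n}]\<^bsup>2\<^esup> \<rightarrow> {1..k}"

definition color_alpha :: "nat \<Rightarrow> (nat set \<Rightarrow> nat) \<Rightarrow> nat \<Rightarrow> nat" where
  "color_alpha n f i = independence_number {1..n} {e \<in> [{1..n}]\<^bsup>2\<^esup>. f e = i}"

text \<open>The list \<open>[m\<^sub>1, \<dots>, m\<^sub>k]\<close> is indexed from 0, the colors from 1.\<close>

definition complementary_Ramsey :: "nat list \<Rightarrow> nat" where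
  "complementary_Ramsey ms =
     (LEAST n. n > 0 \<and>
        (\<forall>f \<in> edge_colorings n (length ms).
           \<exists>i \<in> {1..length ms}. color_alpha n f i \<ge> ms ! (i - 1)))"

end

theory Submission
  imports Defs
begin

text \<open>
  The vertices joined to \<open>v\<close> by a colour other than \<open>i\<close> carry a colouring whose colour \<open>i\<close> has
  independence number smaller by one. Bounding the size of these sets inductively gives upper
  bounds on the sums of two of the three colour degrees of \<open>v\<close>, while all three sum to
  \<open>n - 1\<close>. For \<open>(a,3,3)\<close> and \<open>(4,4,3)\<close> this is already contradictory or nearly so. For
  \<open>(a,4,3)\<close> on 9 vertices colour 2 would be 3-regular, against the handshake lemma; for
  \<open>(4,4,4)\<close> on 10 vertices every colour would be a cubic graph without \<open>K\<^sub>4\<close> and without an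
  independent set of size 4. For \<open>(6,4,3)\<close> on 8 vertices, the vertices meeting colour 1 have
  degree 2 in colour 2 and are closed under colour-2 adjacency, which forces a colour-2 degree
  of 3 among them.
\<close>

section \<open>Colourings with bounded independence numbers\<close>

definition alpha_less :: "'a set \<Rightarrow> ('a set \<Rightarrow> 'b) \<Rightarrow> 'b \<Rightarrow> nat \<Rightarrow> bool" where
  "alpha_less V c i m \<longleftrightarrow>
     (\<forall>S\<subseteq>V. (\<forall>x\<in>S. \<forall>y\<in>S. x \<noteq> y \<longrightarrow> c {x, y} \<noteq> i) \<longrightarrow> card S < m)"

text \<open>Each colour is followed by the bound that its independence number must stay below.\<close>

definition avoids ::
  "'a set \<Rightarrow> ('a set \<Rightarrow> 'b) \<Rightarrow> 'b \<Rightarrow> nat \<Rightarrow> 'b \<Rightarrow> nat \<Rightarrow> 'b \<Rightarrow> nat \<Rightarrow> bool" where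
  "avoids V c i m\<^sub>i j m\<^sub>j k m\<^sub>k \<longleftrightarrow>
     finite V \<and> distinct [i, j, k] \<and> (\<forall>x\<in>V. \<forall>y\<in>V. x \<noteq> y \<longrightarrow> c {x, y} \<in> {i, j, k}) \<and>
     alpha_less V c i m\<^sub>i \<and> alpha_less V c j m\<^sub>j \<and> alpha_less V c k m\<^sub>k"

definition nbrs :: "'a set \<Rightarrow> ('a set \<Rightarrow> 'b) \<Rightarrow> 'b \<Rightarrow> 'a \<Rightarrow> 'a set" where
  "nbrs V c i v = {w \<in> V. w \<noteq> v \<and> c {v, w} = i}"

definition non_nbrs :: "'a set \<Rightarrow> ('a set \<Rightarrow> 'b) \<Rightarrow> 'b \<Rightarrow> 'a \<Rightarrow> 'a set" where
  "non_nbrs V c i v = {w \<in> V. w \<noteq> v \<and> c {v, w} \<noteq> i}"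

lemma finite_nbrs [simp]: "finite V \<Longrightarrow> finite (nbrs V c i v)"
  by (simp add: nbrs_def)

lemma nbrs_sym: "w \<in> nbrs V c i v \<Longrightarrow> v \<in> V \<Longrightarrow> v \<in> nbrs V c i w"
  by (auto simp: nbrs_def insert_commute)

lemma alpha_lessD:
  assumes "alpha_less V c i m" "S \<subseteq> V" "m \<le> card S"
  shows "\<exists>x\<in>S. \<exists>y\<in>S. x \<noteq> y \<and> c {x, y} = i"
  using assms by (meson alpha_less_def not_less)

lemma alpha_less_mono: "alpha_less V c i m \<Longrightarrow> W \<subseteq> V \<Longrightarrow> m \<le> n \<Longrightarrow> alpha_less W c i n"
  by (fastforce simp: alpha_less_def)

lemma avoids_swap12: "avoids V c i a j b k d \<Longrightarrow> avoids V c j b i a k d"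
  by (auto simp: avoids_def)

lemma avoids_swap23: "avoids V c i a j b k d \<Longrightarrow> avoids V c i a k d j b"
  by (auto simp: avoids_def)

lemma avoids_mono:
  assumes "avoids V c i a j b k d" "W \<subseteq> V" "a \<le> a'" "b \<le> b'" "d \<le> d'"
  shows "avoids W c i a' j b' k d'"
  using assms unfolding avoids_def
  by (meson alpha_less_mono finite_subset subsetD)

text \<open>Restricting to exactly \<open>n\<close> vertices fixes the sum of the three colour
  degrees of each vertex.\<close>

lemma avoids_subset_card:
  assumes "avoids V c i a j b k d" "n \<le> card V"
  obtains W where "card W = n" "avoids W c i a j b k d"
proof -
  obtain W where "W \<subseteq> V" "card W = n" using assms(2) obtain_subset_with_card_n by metis
  with that avoids_mono [OF assms(1)] show thesis by blast
qed

section \<open>Colour degrees of a vertex and its sets of non-neighbours\<close>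

lemma avoids_degree_sum:
  assumes "avoids V c i a j b k d" "v \<in> V"
  shows "card V = Suc (card (nbrs V c i v) + card (nbrs V c j v) + card (nbrs V c k v))"
proof -
  have fin: "finite V" and ne: "i \<noteq> j" "i \<noteq> k" "j \<noteq> k"
    using assms by (auto simp: avoids_def)
  have "V = insert v (nbrs V c i v \<union> nbrs V c j v \<union> nbrs V c k v)"
    using assms by (auto simp: avoids_def nbrs_def)
  moreover have "card (insert v (nbrs V c i v \<union> nbrs V c j v \<union> nbrs V c k v))
      = Suc (card (nbrs V c i v \<union> nbrs V c j v \<union> nbrs V c k v))"
    using fin by (subst card_insert_disjoint) (auto simp: nbrs_def)
  moreover have "card (nbrs V c i v \<union> nbrs V c j v \<union> nbrs V c k v)
      = card (nbrs V c i v) + card (nbrs V c j v) + card (nbrs V c k v)"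
    using fin ne by (subst card_Un_disjoint; (subst card_Un_disjoint)?) (auto simp: nbrs_def)
  ultimately show ?thesis by simp
qed

lemma card_non_nbrs:
  assumes "avoids V c i a j b k d" "v \<in> V"
  shows "card (non_nbrs V c i v) = card (nbrs V c j v) + card (nbrs V c k v)"
proof -
  have "non_nbrs V c i v = nbrs V c j v \<union> nbrs V c k v"
    using assms by (auto simp: avoids_def nbrs_def non_nbrs_def)
  then show ?thesis
    using assms by (simp, subst card_Un_disjoint) (auto simp: avoids_def nbrs_def)
qed

text \<open>Adding \<open>v\<close> to a colour-\<open>i\<close> independent set of its
  non-neighbours keeps the set independent.\<close>

lemma avoids_non_nbrs:
  assumes av: "avoids V c i (Suc a) j b k d" and v: "v \<in> V"
  shows "avoids (non_nbrs V c i v) c i a j b k d"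
proof -
  have sub: "non_nbrs V c i v \<subseteq> V" by (auto simp: non_nbrs_def)
  have "alpha_less (non_nbrs V c i v) c i a"
    unfolding alpha_less_def
  proof (intro allI impI)
    fix S assume S: "S \<subseteq> non_nbrs V c i v" "\<forall>x\<in>S. \<forall>y\<in>S. x \<noteq> y \<longrightarrow> c {x, y} \<noteq> i"
    have "finite S" using av S(1) sub by (meson avoids_def finite_subset subset_trans)
    moreover have "v \<notin> S" using S by (auto simp: non_nbrs_def)
    moreover have "insert v S \<subseteq> V" using S sub v by auto
    moreover have "\<forall>x\<in>insert v S. \<forall>y\<in>insert v S. x \<noteq> y \<longrightarrow> c {x, y} \<noteq> i"
      using S by (auto simp: non_nbrs_def insert_commute)
    ultimately show "card S < a"
      using av unfolding avoids_def alpha_less_def by (metis Suc_less_eq card_insert_disjoint)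
  qed
  with avoids_mono [OF av sub order_refl order_refl order_refl] show ?thesis
    by (simp add: avoids_def)
qed

text \<open>No two vertices are independent in colour \<open>i\<close>, so every pair has that
  colour and \<open>V\<close> itself is independent in colour \<open>j\<close>.\<close>

lemma avoids_2_bound:
  assumes "avoids V c i 2 j b k d"
  shows "card V < b"
proof -
  have "c {x, y} = i" if "x \<in> V" "y \<in> V" "x \<noteq> y" for x y
  proof -
    have "alpha_less V c i 2" using assms by (simp add: avoids_def)
    then have "\<exists>u\<in>{x, y}. \<exists>w\<in>{x, y}. u \<noteq> w \<and> c {u, w} = i"
      by (rule alpha_lessD) (use that in auto)
    then show ?thesis by (auto simp: insert_commute)
  qed
  then show ?thesis using assms by (auto simp: avoids_def alpha_less_def)
qed

lemma degree_pair_bound_2: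
  assumes "avoids V c i 3 j b k d" "v \<in> V"
  shows "card (nbrs V c j v) + card (nbrs V c k v) < b"
  using avoids_2_bound avoids_non_nbrs card_non_nbrs assms
  by (metis numeral_2_eq_2 numeral_3_eq_3)

section \<open>Upper bounds for (a,3,3)\<close>

lemma avoids_a33_degrees:
  assumes av: "avoids V c i a j 3 k 3" and "v \<in> V"
  shows "card (nbrs V c i v) + card (nbrs V c k v) \<le> 2"
    and "card (nbrs V c i v) + card (nbrs V c j v) \<le> 2"
  using degree_pair_bound_2 [OF avoids_swap23 [OF avoids_swap12 [OF avoids_swap23 [OF av]]] \<open>v \<in> V\<close>]
    degree_pair_bound_2 [OF avoids_swap23 [OF avoids_swap12 [OF av]] \<open>v \<in> V\<close>]
  by linarith+

text \<open>The two pair bounds together count every colour, so the three degrees sum to at most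
  4.\<close>

lemma avoids_a33_bound:
  assumes "avoids V c i a j 3 k 3"
  shows "card V \<le> 5"
proof (rule ccontr)
  assume "\<not> card V \<le> 5"
  then obtain v where v: "v \<in> V" by fastforce
  show False
    using avoids_degree_sum [OF assms v] avoids_a33_degrees [OF assms v] \<open>\<not> card V \<le> 5\<close> by linarith
qed

text \<open>On 5 or more vertices the degree sum is at least 4, which forces all
  colour-\<open>i\<close> degrees to be 0; then \<open>V\<close> is independent in colour
  \<open>i\<close>.\<close>

lemma avoids_533_bound:
  assumes "avoids V c i 5 j 3 k 3"
  shows "card V \<le> 4"
proof (rule ccontr)
  assume "\<not> card V \<le> 4"
  have "card (nbrs V c i v) = 0" if "v \<in> V" for v
    using avoids_degree_sum [OF assms that] avoids_a33_degrees [OF assms that] \<open>\<not> card V \<le> 4\<close>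
    by linarith
  moreover have "\<exists>x\<in>V. \<exists>y\<in>V. x \<noteq> y \<and> c {x, y} = i"
    by (rule alpha_lessD [of V c i 5]) (use assms \<open>\<not> card V \<le> 4\<close> in \<open>auto simp: avoids_def\<close>)
  ultimately show False using assms by (fastforce simp: avoids_def nbrs_def)
qed

section \<open>Upper bound for (4,4,3)\<close>

lemma degree_pair_bound_433:
  assumes "avoids V c i 4 j 4 k 3" "v \<in> V"
  shows "card (nbrs V c j v) + card (nbrs V c k v) \<le> 4"
proof -
  have "avoids (non_nbrs V c i v) c j 4 i 3 k 3"
    using avoids_swap12 avoids_non_nbrs assms by (metis eval_nat_numeral(2) semiring_norm(26,27,28))
  then have "avoids (non_nbrs V c i v) c j 5 i 3 k 3"
    by (rule avoids_mono) auto
  from avoids_533_bound [OF this] card_non_nbrs [OF assms] show ?thesis by simp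
qed

text \<open>The pair sums are at most 4, 4 and 3 and count each degree twice, so the degree sum is
  at most 5.\<close>

lemma avoids_443_bound:
  assumes av: "avoids V c i 4 j 4 k 3"
  shows "card V \<le> 6"
proof (rule ccontr)
  assume "\<not> card V \<le> 6"
  then obtain v where v: "v \<in> V" by fastforce
  show False
    using avoids_degree_sum [OF av v] degree_pair_bound_433 [OF av v]
      degree_pair_bound_433 [OF avoids_swap12 [OF av] v]
      degree_pair_bound_2 [OF avoids_swap12 [OF avoids_swap23 [OF av]] v] \<open>\<not> card V \<le> 6\<close>
    by linarith
qed

section \<open>Upper bounds for (a,4,3)\<close>

lemma avoids_a43_degrees:
  assumes av: "avoids V c i a j 4 k 3" and v: "v \<in> V"
  shows "card (nbrs V c i v) + card (nbrs V c j v) \<le> 3"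
    and "card (nbrs V c i v) + card (nbrs V c k v) \<le> 5"
proof -
  show "card (nbrs V c i v) + card (nbrs V c j v) \<le> 3"
    using degree_pair_bound_2 [OF avoids_swap12 [OF avoids_swap23 [OF avoids_swap12 [OF av]]] v]
    by simp
  have "avoids V c j (Suc 3) i a k 3" using avoids_swap12 [OF av] by simp
  from avoids_a33_bound [OF avoids_swap12 [OF avoids_non_nbrs [OF this v]]]
    card_non_nbrs [OF this v]
  show "card (nbrs V c i v) + card (nbrs V c k v) \<le> 5" by simp
qed

lemma avoids_643_bound:
  assumes "avoids V c i 6 j 4 k 3"
  shows "card V \<le> 7"
proof (rule ccontr)
  assume "\<not> card V \<le> 7"
  then obtain U where U: "card U = 8" and av: "avoids U c i 6 j 4 k 3"
    using avoids_subset_card [OF assms, of 8] by auto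
  have fin: "finite U" using av by (simp add: avoids_def)
  have deg: "card (nbrs U c j v) \<ge> 2" "card (nbrs U c i v) + card (nbrs U c j v) \<le> 3"
    if "v \<in> U" for v
    using avoids_degree_sum [OF av that] avoids_a43_degrees [OF av that] U by linarith+
  let ?W = "\<lambda>u. non_nbrs U c j u"
  \<comment> \<open>Consequences of a colour-\<open>i\<close> edge at \<open>u\<close>. By the last
    one, having such an edge passes on to colour-\<open>j\<close> neighbours.\<close>
  have step: "card (nbrs U c j u) = 2 \<and> (\<forall>w \<in> ?W u. card (nbrs (?W u) c j w) = 2)
      \<and> (\<forall>a \<in> nbrs U c j u. nbrs U c i a \<noteq> {})"
    if u: "u \<in> U" and ne: "nbrs U c i u \<noteq> {}" for u
  proof -
    have "card (nbrs U c i u) > 0" using ne fin by (simp add: card_gt_0_iff)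
    then have 2: "card (nbrs U c j u) = 2" using deg [OF u] by linarith
    have "avoids U c j (Suc 3) i 6 k 3" using avoids_swap12 [OF av] by simp
    note avW = avoids_swap12 [OF avoids_non_nbrs [OF this u]]
    have W5: "card (?W u) = 5"
      using card_non_nbrs [OF avoids_swap12 [OF av] u] avoids_degree_sum [OF av u] 2 U by linarith
    \<comment> \<open>On five vertices the degree sum 4 is the most that the (a,3,3) pair bounds
      allow, so they are attained and colour \<open>i\<close> is absent.\<close>
    have W: "card (nbrs (?W u) c i w) = 0 \<and> card (nbrs (?W u) c j w) = 2" if "w \<in> ?W u" for w
      using avoids_degree_sum [OF avW that] avoids_a33_degrees [OF avW that] W5 by linarith
    have finW: "finite (?W u)" using avW by (simp add: avoids_def)
    have "nbrs U c i a \<noteq> {}" if a: "a \<in> nbrs U c j u" for a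
    proof -
      \<comment> \<open>These six vertices contain a colour-\<open>i\<close> pair; none lies inside
        \<open>?W u\<close>, so the pair contains \<open>a\<close>.\<close>
      have "a \<notin> ?W u" "insert a (?W u) \<subseteq> U" using a by (auto simp: nbrs_def non_nbrs_def)
      then have "\<exists>x\<in>insert a (?W u). \<exists>y\<in>insert a (?W u). x \<noteq> y \<and> c {x, y} = i"
        using av W5 finW by (intro alpha_lessD [of U c i 6]) (auto simp: avoids_def)
      then obtain x y where xy: "x \<in> insert a (?W u)" "y \<in> insert a (?W u)" "x \<noteq> y" "c {x, y} = i"
        by blast
      have "\<not> (x \<in> ?W u \<and> y \<in> ?W u)"
        using W [of x] xy finW by (auto simp: nbrs_def)
      then show ?thesis
        using xy \<open>insert a (?W u) \<subseteq> U\<close> by (auto simp: nbrs_def insert_commute)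
    qed
    then show ?thesis using 2 W by blast
  qed
  have "\<exists>x\<in>U. \<exists>y\<in>U. x \<noteq> y \<and> c {x, y} = i"
    by (rule alpha_lessD [of U c i 6]) (use av U in \<open>auto simp: avoids_def\<close>)
  then obtain u where u: "u \<in> U" "nbrs U c i u \<noteq> {}" by (fastforce simp: nbrs_def)
  then obtain a where a: "a \<in> nbrs U c j u"
    using step by (metis card.empty equals0I zero_neq_numeral)
  then have aU: "a \<in> U" "nbrs U c i a \<noteq> {}" using step u by (auto simp: nbrs_def)
  then have "card (nbrs U c j a) = 2" using step by blast
  then obtain a' where a': "a' \<in> nbrs U c j a" "a' \<noteq> u"
    by (metis One_nat_def card_2_iff' )
  \<comment> \<open>Otherwise \<open>u\<close>, \<open>a\<close>, \<open>a'\<close> form a triangle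
    in colour \<open>j\<close>, hence an independent set of size 3 in colour
    \<open>k\<close>.\<close>
  have "a' \<notin> nbrs U c j u"
  proof
    assume "a' \<in> nbrs U c j u"
    then have "\<exists>x\<in>{u, a, a'}. \<exists>y\<in>{u, a, a'}. x \<noteq> y \<and> c {x, y} = k"
      using av a a' u by (intro alpha_lessD [of U c k 3]) (auto simp: avoids_def nbrs_def)
    then show False
      using av a a' \<open>a' \<in> nbrs U c j u\<close> by (auto simp: avoids_def nbrs_def insert_commute)
  qed
  then have a'W: "a' \<in> ?W u" using a' by (auto simp: nbrs_def non_nbrs_def)
  have "a' \<in> U" "nbrs U c i a' \<noteq> {}" using step aU a' by (auto simp: nbrs_def)
  then have "card (nbrs U c j a') = 2" using step by blast
  \<comment> \<open>Besides its two colour-\<open>j\<close> neighbours inside \<open>?W u\<close>,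
    the vertex \<open>a'\<close> has \<open>a\<close> as a third.\<close>
  moreover have "insert a (nbrs (?W u) c j a') \<subseteq> nbrs U c j a'"
    using nbrs_sym [OF a'(1) aU(1)] by (auto simp: nbrs_def non_nbrs_def)
  then have "card (insert a (nbrs (?W u) c j a')) \<le> card (nbrs U c j a')"
    using fin by (intro card_mono) auto
  moreover have "a \<notin> nbrs (?W u) c j a'" using a by (auto simp: nbrs_def non_nbrs_def)
  moreover have "card (nbrs (?W u) c j a') = 2" using step u a'W by blast
  moreover have "finite (?W u)" using fin by (simp add: non_nbrs_def)
  ultimately show False by simp
qed

text \<open>Handshake lemma: counting incidences by edges gives two for each edge.\<close>

lemma even_degree_sum:
  assumes fin: "finite V"
  shows "even (\<Sum>v\<in>V. card (nbrs V c i v))"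
proof -
  define E where "E = {e \<in> [V]\<^bsup>2\<^esup>. c e = i}"
  have "finite E" using fin by (simp add: E_def finite_imp_finite_nsets)
  have "card (nbrs V c i v) = card {e \<in> E. v \<in> e}" if "v \<in> V" for v
  proof (rule bij_betw_same_card [of "\<lambda>w. {v, w}"])
    show "bij_betw (\<lambda>w. {v, w}) (nbrs V c i v) {e \<in> E. v \<in> e}"
      unfolding bij_betw_def
    proof
      show "inj_on (\<lambda>w. {v, w}) (nbrs V c i v)"
        by (auto simp: inj_on_def nbrs_def doubleton_eq_iff)
      show "(\<lambda>w. {v, w}) ` nbrs V c i v = {e \<in> E. v \<in> e}"
        using that by (fastforce simp: E_def nbrs_def nsets_def card_2_iff insert_commute)
    qed
  qed
  then have "(\<Sum>v\<in>V. card (nbrs V c i v)) = (\<Sum>v\<in>V. card {e \<in> E. v \<in> e})" by simp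
  also have "\<dots> = 2 * card E"
  proof (rule sum_multicount [OF fin \<open>finite E\<close>], intro ballI)
    fix e assume "e \<in> E"
    then have "{v \<in> V. v \<in> e} = e" "card e = 2" by (auto simp: E_def nsets_def)
    then show "card {v \<in> V. v \<in> e} = 2" by simp
  qed
  finally show ?thesis by simp
qed

lemma avoids_a43_bound:
  assumes "avoids V c i a j 4 k 3"
  shows "card V \<le> 8"
proof (rule ccontr)
  assume "\<not> card V \<le> 8"
  then obtain U where U: "card U = 9" and av: "avoids U c i a j 4 k 3"
    using avoids_subset_card [OF assms, of 9] by auto
  \<comment> \<open>The degree sum is 8; the pair bounds 3 and 5 bound the colour-\<open>j\<close>
    degree from above and from below.\<close>
  have "card (nbrs U c j v) = 3" if "v \<in> U" for v
    using avoids_degree_sum [OF av that] avoids_a43_degrees [OF av that] U by linarith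
  then have "(\<Sum>v\<in>U. card (nbrs U c j v)) = 27" using U by simp
  moreover have "finite U" using av by (simp add: avoids_def)
  ultimately show False using even_degree_sum [of U c j] by simp
qed

section \<open>Upper bound for (4,4,4)\<close>

lemma degree_pair_bound_444:
  assumes av: "avoids V c i 4 j 4 k 4" and v: "v \<in> V"
  shows "card (nbrs V c j v) + card (nbrs V c k v) \<le> 6"
proof -
  have "avoids V c i (Suc 3) j 4 k 4" using av by simp
  from avoids_443_bound [OF avoids_swap23 [OF avoids_swap12 [OF avoids_non_nbrs [OF this v]]]]
    card_non_nbrs [OF av v]
  show ?thesis by simp
qed

lemma card_3_one_elem:
  assumes "card A = 3" "x \<in> A"
  shows "\<exists>y z. A = {x, y, z} \<and> y \<noteq> z \<and> y \<noteq> x \<and> z \<noteq> x"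
proof -
  have "card (A - {x}) = 2" using assms by simp
  then obtain y z where "A - {x} = {y, z}" "y \<noteq> z" by (auto simp: card_2_iff)
  with \<open>x \<in> A\<close> show ?thesis by blast
qed

lemma card_3_two_elems:
  assumes "card A = 3" "x \<in> A" "y \<in> A" "x \<noteq> y"
  shows "\<exists>z. A = {x, y, z} \<and> z \<noteq> x \<and> z \<noteq> y"
proof -
  have "card (A - {x, y}) = 1" using assms by (simp add: card_Diff_subset)
  then obtain z where "A - {x, y} = {z}" by (rule card_1_singletonE)
  with assms show ?thesis by blast
qed

text \<open>This is Brooks' theorem on ten vertices: a 3-colouring of a cubic graph without \<open>K\<^sub>4\<close>
  would have a colour class of size 4.\<close>

lemma cubic_10_clique_or_indep:
  assumes fin: "finite V" and V: "card V = 10"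
    and cubic: "\<And>v. v \<in> V \<Longrightarrow> card (nbrs V c i v) = 3"
    and clique: "\<And>S. S \<subseteq> V \<Longrightarrow> card S = 4 \<Longrightarrow> \<exists>x\<in>S. \<exists>y\<in>S. x \<noteq> y \<and> c {x, y} \<noteq> i"
    and indep: "\<And>S. S \<subseteq> V \<Longrightarrow> card S = 4 \<Longrightarrow> \<exists>x\<in>S. \<exists>y\<in>S. x \<noteq> y \<and> c {x, y} = i"
  shows False
proof -
  define N where "N = nbrs V c i"
  define R where "R v w = V - ({v, w} \<union> N v \<union> N w)" for v w
  have N_iff: "y \<in> N x \<longleftrightarrow> y \<in> V \<and> y \<noteq> x \<and> c {x, y} = i" for x y
    by (simp add: N_def nbrs_def)
  have N_sym: "y \<in> N x \<longleftrightarrow> x \<in> N y" if "x \<in> V" "y \<in> V" for x y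
    using that by (auto simp: N_iff insert_commute)
  have N3: "card (N x) = 3" if "x \<in> V" for x using cubic that by (simp add: N_def)
  have finN: "finite (N x)" for x using fin by (simp add: N_def)
  have no_K4: False if "a \<in> V" "b \<in> N a" "d \<in> N a" "e \<in> N a" "d \<in> N b" "e \<in> N b" "e \<in> N d"
    for a b d e
  proof -
    have "\<exists>x\<in>{a, b, d, e}. \<exists>y\<in>{a, b, d, e}. x \<noteq> y \<and> c {x, y} \<noteq> i"
      using that by (intro clique) (auto simp: N_iff)
    then show False using that by (auto simp: N_iff insert_commute)
  qed
  \<comment> \<open>A non-adjacent pair in \<open>R v w\<close> would extend \<open>{v, w}\<close>
    to an independent set of size 4.\<close>
  have R_clique: "y \<in> N x"
    if "v \<in> V" "w \<in> V" "v \<noteq> w" "w \<notin> N v" "x \<in> R v w" "y \<in> R v w" "x \<noteq> y" for v w x y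
  proof (rule ccontr)
    assume "y \<notin> N x"
    have "\<exists>p\<in>{v, w, x, y}. \<exists>q\<in>{v, w, x, y}. p \<noteq> q \<and> c {p, q} = i"
      using that by (intro indep) (auto simp: R_def)
    then show False using that \<open>y \<notin> N x\<close> by (auto simp: N_iff R_def insert_commute)
  qed
  have card_R: "card (R v w) = 2 + card (N v \<inter> N w)"
    if "v \<in> V" "w \<in> V" "v \<noteq> w" "w \<notin> N v" for v w
  proof -
    have "card ({v, w} \<union> (N v \<union> N w)) = 2 + card (N v \<union> N w)"
      using that finN N_sym [of v w] by (subst card_Un_disjoint) (auto simp: N_iff)
    moreover have "card (N v) + card (N w) = card (N v \<union> N w) + card (N v \<inter> N w)"
      by (rule card_Un_Int) (rule finN)+
    moreover have "card (R v w) = card V - card ({v, w} \<union> (N v \<union> N w))"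
      unfolding R_def Un_assoc
      by (rule card_Diff_subset) (use finN that in \<open>auto simp: N_iff\<close>)
    ultimately show ?thesis using N3 that V by simp
  qed
  \<comment> \<open>The clique \<open>R v w\<close> has at most 3 vertices, while the common
    neighbour \<open>p\<close> makes it at least 3; so it is a triangle and \<open>p\<close> is the
    only common neighbour.\<close>
  have card_R_3: "card (R v w) = 3"
    and common_unique: "\<And>q. q \<in> N v \<Longrightarrow> q \<in> N w \<Longrightarrow> q = p"
    if vw: "v \<in> V" "w \<in> V" "v \<noteq> w" "w \<notin> N v" and p: "p \<in> N v" "p \<in> N w" for v w p
  proof -
    have "card (R v w) < 4"
    proof (rule ccontr)
      assume "\<not> card (R v w) < 4"
      then obtain S where S: "S \<subseteq> R v w" "card S = 4"
        by (metis not_less obtain_subset_with_card_n)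
      then have "S \<subseteq> V" by (auto simp: R_def)
      from clique [OF this S(2)] obtain x y where "x \<in> S" "y \<in> S" "x \<noteq> y" "c {x, y} \<noteq> i" by blast
      then show False using R_clique [OF vw, of x y] S by (auto simp: N_iff)
    qed
    moreover have "card (N v \<inter> N w) > 0" using p finN by (auto simp: card_gt_0_iff)
    ultimately have 1: "card (N v \<inter> N w) = 1" using card_R [OF vw] by linarith
    then show "card (R v w) = 3" using card_R [OF vw] by simp
    fix q assume "q \<in> N v" "q \<in> N w"
    with p have "p \<in> N v \<inter> N w" "q \<in> N v \<inter> N w" by auto
    with 1 show "q = p" by (metis card_1_singletonE singletonD)
  qed
  obtain a where a: "a \<in> V" using V by fastforce
  have "\<exists>x\<in>insert a (N a). \<exists>y\<in>insert a (N a). x \<noteq> y \<and> c {x, y} \<noteq> i"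
    using a finN N3 [OF a] by (intro clique) (auto simp: N_iff)
  then obtain v w where *: "v \<in> insert a (N a)" "w \<in> insert a (N a)" "v \<noteq> w" "c {v, w} \<noteq> i"
    by blast
  then have vw: "v \<in> N a" "w \<in> N a" "v \<noteq> w" "w \<notin> N v"
    by (auto simp: N_iff insert_commute)
  then have vwV: "v \<in> V" "w \<in> V" by (auto simp: N_iff)
  then have "card (R v w) = 3" using card_R_3 [of v w a] vw a N_sym by blast
  then obtain r\<^sub>1 r\<^sub>2 r\<^sub>3 where r: "R v w = {r\<^sub>1, r\<^sub>2, r\<^sub>3}" "r\<^sub>1 \<noteq> r\<^sub>2" "r\<^sub>1 \<noteq> r\<^sub>3" "r\<^sub>2 \<noteq> r\<^sub>3"
    by (metis card_3_iff)
  have rV: "r\<^sub>1 \<in> V" "r\<^sub>2 \<in> V" "r\<^sub>3 \<in> V" using r by (auto simp: R_def)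
  have rN: "r\<^sub>2 \<in> N r\<^sub>1" "r\<^sub>3 \<in> N r\<^sub>1" "r\<^sub>3 \<in> N r\<^sub>2" "r\<^sub>1 \<in> N r\<^sub>2" "r\<^sub>1 \<in> N r\<^sub>3" "r\<^sub>2 \<in> N r\<^sub>3"
    using R_clique [OF vwV vw(3,4)] r by auto
  \<comment> \<open>In a triangle \<open>p\<close>, \<open>q\<close>, \<open>s\<close> the remaining
    neighbour \<open>x\<close> of \<open>p\<close> misses \<open>q\<close> and \<open>s\<close>:
    meeting both gives a \<open>K\<^sub>4\<close>, meeting just one gives a non-adjacent pair with
    two common neighbours.\<close>
  have third: "\<exists>x. N p = {q, s, x} \<and> x \<noteq> q \<and> x \<noteq> s \<and> x \<notin> N q \<and> x \<notin> N s \<and> x \<in> V"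
    if "p \<in> V" "q \<in> V" "s \<in> V" "q \<in> N p" "s \<in> N p" "s \<in> N q" for p q s
  proof -
    have "q \<noteq> s" using that by (auto simp: N_iff)
    moreover have "card (N p) = 3" "q \<in> N p" "s \<in> N p" using that N3 by auto
    ultimately obtain x where x: "N p = {q, s, x}" "x \<noteq> q" "x \<noteq> s"
      using card_3_two_elems by metis
    have xV: "x \<in> V" using x by (auto simp: N_iff)
    have "x \<in> N p" using x by auto
    have "\<not> (x \<in> N q \<and> x \<in> N s)"
      using no_K4 [of p q s x] that \<open>x \<in> N p\<close> by auto
    moreover have "x \<in> N s" if "x \<in> N q"
    proof (rule ccontr)
      assume "x \<notin> N s"
      then have "q = p"
        using common_unique [of s x p q] x xV that \<open>p \<in> V\<close> \<open>q \<in> V\<close> \<open>s \<in> V\<close> \<open>s \<in> N p\<close> \<open>s \<in> N q\<close>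
          \<open>x \<in> N p\<close> N_sym by blast
      then show False using \<open>q \<in> N p\<close> by (auto simp: N_iff)
    qed
    moreover have "x \<in> N q" if "x \<in> N s"
    proof (rule ccontr)
      assume "x \<notin> N q"
      then have "s = p"
        using common_unique [of q x p s] x xV that \<open>p \<in> V\<close> \<open>q \<in> V\<close> \<open>s \<in> V\<close> \<open>q \<in> N p\<close> \<open>s \<in> N q\<close>
          \<open>x \<in> N p\<close> N_sym by blast
      then show False using \<open>s \<in> N p\<close> by (auto simp: N_iff)
    qed
    ultimately show ?thesis using x xV by blast
  qed
  obtain x\<^sub>1 where x1: "N r\<^sub>1 = {r\<^sub>2, r\<^sub>3, x\<^sub>1}" "x\<^sub>1 \<noteq> r\<^sub>2" "x\<^sub>1 \<noteq> r\<^sub>3" "x\<^sub>1 \<notin> N r\<^sub>2" "x\<^sub>1 \<notin> N r\<^sub>3" "x\<^sub>1 \<in> V"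
    using third [of r\<^sub>1 r\<^sub>2 r\<^sub>3] rV rN by blast
  obtain x\<^sub>2 where x2: "N r\<^sub>2 = {r\<^sub>1, r\<^sub>3, x\<^sub>2}" "x\<^sub>2 \<noteq> r\<^sub>1" "x\<^sub>2 \<noteq> r\<^sub>3" "x\<^sub>2 \<notin> N r\<^sub>1" "x\<^sub>2 \<notin> N r\<^sub>3" "x\<^sub>2 \<in> V"
    using third [of r\<^sub>2 r\<^sub>1 r\<^sub>3] rV rN by blast
  obtain x\<^sub>3 where x3: "N r\<^sub>3 = {r\<^sub>1, r\<^sub>2, x\<^sub>3}" "x\<^sub>3 \<noteq> r\<^sub>1" "x\<^sub>3 \<noteq> r\<^sub>2" "x\<^sub>3 \<notin> N r\<^sub>1" "x\<^sub>3 \<notin> N r\<^sub>2" "x\<^sub>3 \<in> V"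
    using third [of r\<^sub>3 r\<^sub>1 r\<^sub>2] rV rN by blast
  have x1r: "r\<^sub>2 \<notin> N x\<^sub>1" "r\<^sub>3 \<notin> N x\<^sub>1" "r\<^sub>1 \<in> N x\<^sub>1" using x1 rV N_sym by blast+
  \<comment> \<open>If \<open>x\<^sub>1\<close> and \<open>x\<^sub>3\<close> were adjacent, the
    non-adjacent \<open>x\<^sub>1\<close> and \<open>r\<^sub>3\<close> would have the two common
    neighbours \<open>r\<^sub>1\<close> and \<open>x\<^sub>3\<close>.\<close>
  have x3R: "x\<^sub>3 \<in> R x\<^sub>1 r\<^sub>2"
  proof -
    have "x\<^sub>3 \<notin> N x\<^sub>1"
      using common_unique [of x\<^sub>1 r\<^sub>3 r\<^sub>1 x\<^sub>3] x1 x3 x1r rV by blast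
    then show ?thesis using x1 x2 x3 by (auto simp: R_def)
  qed
  have x2R: "x\<^sub>2 \<in> R x\<^sub>1 r\<^sub>3"
  proof -
    have "x\<^sub>2 \<notin> N x\<^sub>1"
      using common_unique [of x\<^sub>1 r\<^sub>2 r\<^sub>1 x\<^sub>2] x1 x2 x1r rV by blast
    then show ?thesis using x1 x2 x3 by (auto simp: R_def)
  qed
  have "card (R x\<^sub>1 r\<^sub>2) = 3"
    using card_R_3 [of x\<^sub>1 r\<^sub>2 r\<^sub>1] x1 x2 x1r rV by blast
  then obtain y z where yz: "R x\<^sub>1 r\<^sub>2 = {x\<^sub>3, y, z}" "y \<noteq> z" "y \<noteq> x\<^sub>3" "z \<noteq> x\<^sub>3"
    using x3R card_3_one_elem by metis
  have yz3: "y \<in> N x\<^sub>3" "z \<in> N x\<^sub>3" "z \<in> N y"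
    using R_clique [of x\<^sub>1 r\<^sub>2] x1 x1r rV yz by auto
  have "y \<in> R x\<^sub>1 r\<^sub>2" "z \<in> R x\<^sub>1 r\<^sub>2" using yz by auto
  \<comment> \<open>The neighbours of \<open>r\<^sub>3\<close> are \<open>r\<^sub>1\<close>,
    \<open>r\<^sub>2\<close>, \<open>x\<^sub>3\<close>, so \<open>y\<close> and \<open>z\<close>
    also lie in the clique around \<open>x\<^sub>2\<close>.\<close>
  then have yzR: "y \<in> R x\<^sub>1 r\<^sub>3" "z \<in> R x\<^sub>1 r\<^sub>3" "y \<noteq> x\<^sub>2" "z \<noteq> x\<^sub>2"
    using x2 x3 yz by (auto simp: R_def)
  then have yz2: "y \<in> N x\<^sub>2" "z \<in> N x\<^sub>2"
    using R_clique [of x\<^sub>1 r\<^sub>3 x\<^sub>2] x1 x1r rV x2R by blast+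
  have "x\<^sub>2 \<noteq> x\<^sub>3" using x2 x3 by auto
  \<comment> \<open>With the two common neighbours \<open>y\<close> and \<open>z\<close>, these
    vertices must be adjacent, which completes a \<open>K\<^sub>4\<close>.\<close>
  then have "x\<^sub>3 \<in> N x\<^sub>2"
    using common_unique [of x\<^sub>2 x\<^sub>3 y z] yz2 yz3 yz x2 x3 by blast
  then show False using no_K4 [of x\<^sub>2 x\<^sub>3 y z] yz2 yz3 x2 by blast
qed

lemma avoids_444_bound:
  assumes "avoids V c i 4 j 4 k 4"
  shows "card V \<le> 9"
proof (rule ccontr)
  assume "\<not> card V \<le> 9"
  then obtain U where U: "card U = 10" and av: "avoids U c i 4 j 4 k 4"
    using avoids_subset_card [OF assms, of 10] by auto
  show False
  proof (rule cubic_10_clique_or_indep)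
    show "finite U" "card U = 10" using av U by (auto simp: avoids_def)
    \<comment> \<open>The degree sum is 9 and each pair sums to at most 6, so every degree is at
      least 3.\<close>
    show "card (nbrs U c i v) = 3" if "v \<in> U" for v
      using avoids_degree_sum [OF av that] degree_pair_bound_444 [OF av that]
        degree_pair_bound_444 [OF avoids_swap12 [OF av] that]
        degree_pair_bound_444 [OF avoids_swap12 [OF avoids_swap23 [OF av]] that] U
      by linarith
    fix S assume S: "S \<subseteq> U" "card S = 4"
    show "\<exists>x\<in>S. \<exists>y\<in>S. x \<noteq> y \<and> c {x, y} = i"
      using S av by (intro alpha_lessD [of U c i 4]) (auto simp: avoids_def)
    have "\<exists>x\<in>S. \<exists>y\<in>S. x \<noteq> y \<and> c {x, y} = j"
      using S av by (intro alpha_lessD [of U c j 4]) (auto simp: avoids_def)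
    then show "\<exists>x\<in>S. \<exists>y\<in>S. x \<noteq> y \<and> c {x, y} \<noteq> i"
      using av by (auto simp: avoids_def)
  qed
qed

section \<open>Translation to the definition of the complementary Ramsey number\<close>

lemma independence_number_less_iff:
  assumes "finite V"
  shows "independence_number V E < m \<longleftrightarrow> (\<forall>S\<subseteq>V. indep S E \<longrightarrow> card S < m)"
proof -
  have "finite {card S |S. S \<subseteq> V \<and> indep S E}"
    using assms by (auto intro: finite_subset [of _ "card ` Pow V"])
  moreover have "card {} \<in> {card S |S. S \<subseteq> V \<and> indep S E}"
    by (force simp: indep_def)
  ultimately show ?thesis
    unfolding independence_number_def by (subst Max_less_iff) blast+
qed

lemma color_alpha_less_iff: "color_alpha n f i < m \<longleftrightarrow> alpha_less {1..n} f i m"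
proof -
  have "indep S {e \<in> [{1..n}]\<^bsup>2\<^esup>. f e = i} \<longleftrightarrow> (\<forall>x\<in>S. \<forall>y\<in>S. x \<noteq> y \<longrightarrow> f {x, y} \<noteq> i)"
    if "S \<subseteq> {1..n}" for S
  proof -
    have "{x, y} \<in> [{1..n}]\<^bsup>2\<^esup>" if "x \<in> S" "y \<in> S" "x \<noteq> y" for x y
      using that \<open>S \<subseteq> {1..n}\<close> unfolding doubleton_in_nsets_2 by blast
    then show ?thesis unfolding indep_def by blast
  qed
  then show ?thesis
    unfolding color_alpha_def independence_number_less_iff [OF finite_atLeastAtMost] alpha_less_def
    by blast
qed

lemma edge_colorings_iff:
  "f \<in> edge_colorings n 3 \<longleftrightarrow> (\<forall>x\<in>{1..n}. \<forall>y\<in>{1..n}. x \<noteq> y \<longrightarrow> f {x, y} \<in> {1, 2, 3})"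
proof -
  have "{1..3::nat} = {1, 2, 3}" by auto
  moreover have "e \<in> [{1..n}]\<^bsup>2\<^esup> \<longleftrightarrow> (\<exists>x\<in>{1..n}. \<exists>y\<in>{1..n}. x \<noteq> y \<and> e = {x, y})" for e
    unfolding nsets_def card_2_iff by blast
  ultimately show ?thesis
    unfolding edge_colorings_def Pi_def by (simp, blast)
qed

text \<open>Identifies avoiding colourings with the counterexamples to the condition under
  \<open>LEAST\<close>.\<close>

lemma avoids_iff_color_alpha:
  "avoids {1..n} f 1 a 2 b 3 d \<longleftrightarrow>
     f \<in> edge_colorings n (length [a, b, d]) \<and>
     \<not> (\<exists>i \<in> {1..length [a, b, d]}. color_alpha n f i \<ge> [a, b, d] ! (i - 1))"
proof -
  have len: "length [a, b, d] = 3" and colors: "{1..3::nat} = {1, 2, 3}" by auto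
  show ?thesis
    unfolding len colors by (simp add: avoids_def edge_colorings_iff color_alpha_less_iff not_le)
qed

text \<open>The colouring \<open>f\<close> restricts to every \<open>k\<close> up to
  \<open>n\<close>, so one example rules out all these values.\<close>

lemma complementary_Ramsey_eqI:
  assumes lower: "avoids {1..n} f (1::nat) a 2 b 3 d"
    and upper: "\<And>V g. avoids V g (1::nat) a 2 b 3 d \<Longrightarrow> card (V::nat set) \<le> n"
  shows "complementary_Ramsey [a, b, d] = Suc n"
  unfolding complementary_Ramsey_def
proof (rule Least_equality)
  show "0 < Suc n \<and> (\<forall>f\<in>edge_colorings (Suc n) (length [a, b, d]).
      \<exists>i\<in>{1..length [a, b, d]}. [a, b, d] ! (i - 1) \<le> color_alpha (Suc n) f i)"
    using upper avoids_iff_color_alpha [of "Suc n" _ a b d] by fastforce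
  fix k assume k: "0 < k \<and> (\<forall>f\<in>edge_colorings k (length [a, b, d]).
      \<exists>i\<in>{1..length [a, b, d]}. [a, b, d] ! (i - 1) \<le> color_alpha k f i)"
  show "Suc n \<le> k"
  proof (rule ccontr)
    assume "\<not> Suc n \<le> k"
    then have "avoids {1..k} f 1 a 2 b 3 d"
      by (intro avoids_mono [OF lower]) auto
    with k avoids_iff_color_alpha [of k f a b d] show False by blast
  qed
qed

section \<open>Verification of explicit colourings by evaluation\<close>

fun no_indep :: "(nat \<Rightarrow> nat \<Rightarrow> nat) \<Rightarrow> nat \<Rightarrow> nat \<Rightarrow> nat list \<Rightarrow> bool" where
  "no_indep t i 0 xs = False"
| "no_indep t i (Suc m) [] = True"
| "no_indep t i (Suc m) (x # xs) =
     (no_indep t i m (filter (\<lambda>y. t x y \<noteq> i) xs) \<and> no_indep t i (Suc m) xs)"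

definition pair_coloring :: "(nat \<Rightarrow> nat \<Rightarrow> nat) \<Rightarrow> nat set \<Rightarrow> nat" where
  "pair_coloring t e = t (Min e) (Max e)"

lemma pair_coloring_less: "x < y \<Longrightarrow> pair_coloring t {x, y} = t x y"
  by (simp add: pair_coloring_def min_def max_def)

text \<open>An independent set either omits the head \<open>x\<close> or has its other elements
  among those kept by the filter. Sortedness ensures that \<open>t\<close> is consulted only at
  \<open>x < y\<close>, where it agrees with \<open>pair_coloring t\<close>.\<close>

lemma no_indep_imp_alpha_less:
  assumes "no_indep t i m xs" "sorted_wrt (<) xs"
  shows "alpha_less (set xs) (pair_coloring t) i m"
  using assms
proof (induction t i m xs rule: no_indep.induct)
  case (3 t i m x xs)
  show ?case
    unfolding alpha_less_def
  proof (intro allI impI)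
    fix S assume S: "S \<subseteq> set (x # xs)"
      and ind: "\<forall>u\<in>S. \<forall>w\<in>S. u \<noteq> w \<longrightarrow> pair_coloring t {u, w} \<noteq> i"
    have finS: "finite S" using S finite_subset by blast
    show "card S < Suc m"
    proof (cases "x \<in> S")
      case True
      have "S - {x} \<subseteq> set (filter (\<lambda>y. t x y \<noteq> i) xs)"
      proof
        fix y assume y: "y \<in> S - {x}"
        then have "y \<in> set xs" "x < y" using S 3 by auto
        then show "y \<in> set (filter (\<lambda>y. t x y \<noteq> i) xs)"
          using ind True y pair_coloring_less [of x y t] by force
      qed
      moreover have "alpha_less (set (filter (\<lambda>y. t x y \<noteq> i) xs)) (pair_coloring t) i m"
        using 3 by (simp add: sorted_wrt_filter)
      ultimately have "card (S - {x}) < m"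
        using ind by (auto simp: alpha_less_def)
      then show ?thesis using True finS by (simp add: card_Diff_singleton)
    next
      case False
      then have "S \<subseteq> set xs" using S by auto
      moreover have "alpha_less (set xs) (pair_coloring t) i (Suc m)" using 3 by simp
      ultimately show ?thesis using ind by (auto simp: alpha_less_def)
    qed
  qed
qed (auto simp: alpha_less_def)

lemma avoids_pair_coloringI:
  assumes range: "\<And>x y. t x y \<in> {1, 2, 3}"
    and "no_indep t 1 a [1..<Suc n]" "no_indep t 2 b [1..<Suc n]" "no_indep t 3 d [1..<Suc n]"
  shows "avoids {1..n} (pair_coloring t) 1 a 2 b 3 d"
proof -
  have "set [1..<Suc n] = {1..n}" by auto
  then have "alpha_less {1..n} (pair_coloring t) i m" if "no_indep t i m [1..<Suc n]" for i m
    using no_indep_imp_alpha_less [OF that sorted_wrt_upt] by (simp only:)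
  then show ?thesis
    using assms by (simp add: avoids_def pair_coloring_def)
qed

text \<open>On \<open>{1..4}\<close> the colours are the three perfect matchings of the complete
  graph.\<close>

definition coloring_4 :: "nat \<Rightarrow> nat \<Rightarrow> nat" where
  "coloring_4 x y = (if y = x + 2 then 2 else if x + y = 5 then 3 else 1)"

text \<open>A 5-cycle in colour 2 and its complementary 5-cycle in colour 3; all five vertices are
  independent in colour 1.\<close>

definition coloring_5 :: "nat \<Rightarrow> nat \<Rightarrow> nat" where
  "coloring_5 x y = (if y = x + 1 \<or> y = x + 4 then 2 else 3)"

text \<open>Two triangles in colour 3; the bipartite graph between them splits into a perfect
  matching in colour 1 and a 6-cycle in colour 2.\<close>

definition coloring_6 :: "nat \<Rightarrow> nat \<Rightarrow> nat" where
  "coloring_6 x y = (if even (x + y) then 3 else if y = x + 1 \<and> odd x then 1 else 2)"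

text \<open>A 7-cycle in colour 2 with three disjoint chords in colour 1.\<close>

definition coloring_7 :: "nat \<Rightarrow> nat \<Rightarrow> nat" where
  "coloring_7 x y =
     (if y = x + 1 \<or> y = x + 6 then 2 else if y = x + 3 \<and> x \<le> 3 then 1 else 3)"

text \<open>Colours 1 and 2 form the Wagner graph: an 8-cycle with its four diameters.\<close>

definition coloring_8 :: "nat \<Rightarrow> nat \<Rightarrow> nat" where
  "coloring_8 x y =
     (if y = x + 1 \<or> y = x + 7 then 2 else if y = x + 4 then if x \<le> 2 then 1 else 2 else 3)"

text \<open>Two parallel classes of lines of the affine plane of order 3.\<close>

definition coloring_9 :: "nat \<Rightarrow> nat \<Rightarrow> nat" where
  "coloring_9 x y =
     (if (x - 1) div 3 = (y - 1) div 3 then 1 else if x mod 3 = y mod 3 then 2 else 3)"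

lemma avoids_coloring_4: "avoids {1..4} (pair_coloring coloring_4) 1 3 2 3 3 3"
  by (rule avoids_pair_coloringI) (simp add: coloring_4_def, code_simp+)

lemma avoids_coloring_5: "avoids {1..5} (pair_coloring coloring_5) 1 6 2 3 3 3"
  by (rule avoids_pair_coloringI) (simp add: coloring_5_def, code_simp+)

lemma avoids_coloring_6: "avoids {1..6} (pair_coloring coloring_6) 1 4 2 4 3 3"
  by (rule avoids_pair_coloringI) (simp add: coloring_6_def, code_simp+)

lemma avoids_coloring_7: "avoids {1..7} (pair_coloring coloring_7) 1 5 2 4 3 3"
  by (rule avoids_pair_coloringI) (simp add: coloring_7_def, code_simp+)

lemma avoids_coloring_8: "avoids {1..8} (pair_coloring coloring_8) 1 7 2 4 3 3"
  by (rule avoids_pair_coloringI) (simp add: coloring_8_def, code_simp+)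

lemma avoids_coloring_9: "avoids {1..9} (pair_coloring coloring_9) 1 4 2 4 3 4"
  by (rule avoids_pair_coloringI) (simp add: coloring_9_def, code_simp+)

theorem theorem6p3:
  shows "(complementary_Ramsey [3,3,3] = 5 \<and> complementary_Ramsey [4,3,3] = 5 \<and>
          complementary_Ramsey [5,3,3] = 5 \<and> complementary_Ramsey [6,3,3] = 6) \<and>
         (complementary_Ramsey [4,4,3] = 7 \<and> complementary_Ramsey [5,4,3] = 8 \<and>
          complementary_Ramsey [6,4,3] = 8 \<and> complementary_Ramsey [7,4,3] = 9) \<and>
         complementary_Ramsey [4,4,4] = 10"
proof -
  \<comment> \<open>By monotonicity the smallest \<open>m\<close> supplies the lower bound and the
    largest \<open>m\<close> the upper bound; likewise for \<open>m43\<close>.\<close>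
  have m33: "complementary_Ramsey [m, 3, 3] = 5" if "3 \<le> m" "m \<le> 5" for m
  proof -
    have "complementary_Ramsey [m, 3, 3] = Suc 4"
    proof (rule complementary_Ramsey_eqI)
      show "avoids {1..4} (pair_coloring coloring_4) 1 m 2 3 3 3"
        by (rule avoids_mono [OF avoids_coloring_4]) (use that in auto)
      show "card V \<le> 4" if "avoids V g (1::nat) m 2 3 3 3" for V :: "nat set" and g
        using avoids_533_bound avoids_mono [OF that order_refl \<open>m \<le> 5\<close> order_refl order_refl] .
    qed
    then show ?thesis by simp
  qed
  have m43: "complementary_Ramsey [m, 4, 3] = 8" if "5 \<le> m" "m \<le> 6" for m
  proof -
    have "complementary_Ramsey [m, 4, 3] = Suc 7"
    proof (rule complementary_Ramsey_eqI)
      show "avoids {1..7} (pair_coloring coloring_7) 1 m 2 4 3 3"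
        by (rule avoids_mono [OF avoids_coloring_7]) (use that in auto)
      show "card V \<le> 7" if "avoids V g (1::nat) m 2 4 3 3" for V :: "nat set" and g
        using avoids_643_bound avoids_mono [OF that order_refl \<open>m \<le> 6\<close> order_refl order_refl] .
    qed
    then show ?thesis by simp
  qed
  have "complementary_Ramsey [6, 3, 3] = Suc 5"
    using avoids_coloring_5 avoids_a33_bound by (rule complementary_Ramsey_eqI)
  moreover have "complementary_Ramsey [4, 4, 3] = Suc 6"
    using avoids_coloring_6 avoids_443_bound by (rule complementary_Ramsey_eqI)
  moreover have "complementary_Ramsey [7, 4, 3] = Suc 8"
    using avoids_coloring_8 avoids_a43_bound by (rule complementary_Ramsey_eqI)
  moreover have "complementary_Ramsey [4, 4, 4] = Suc 9"
    using avoids_coloring_9 avoids_444_bound by (rule complementary_Ramsey_eqI)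
  ultimately show ?thesis
    using m33 m43 by simp
qed

end
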